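(* Let $s\ge 1$, let $c_1,\dots,c_s\in\mathbb{R}$ be distinct, let $\lambda>0$, and consider the parallel ensemble IMEX Euler method of order $s$, with $\mathbf{A}=\mathbf{0}_{s\times s}$, $\widehat{\mathbf{A}}=\lambda\,\mathbf{I}_{s\times s}$, $\mathbf{U}=\mathbf{V}=\mathbf{I}_{s\times s}$, $\mathbf{B}=\mathbf{C}_s\mathbf{F}_s\mathbf{C}_s^{-1}$, $\widehat{\mathbf{B}}=\mathbf{C}_s\mathbf{F}_s(\mathbf{I}_{s\times s}-\lambda\mathbf{K}_s)\mathbf{C}_s^{-1}$. For all $w,\widehat w\in\mathbb{C}$ with $1-\lambda\widehat w\ne 0$, its stability matrix satisfies $$\mathbf{C}_s^{-1}\,\mathbf{M}(w,\widehat w)\,\mathbf{C}_s=\mathbf{I}_{s\times s}+\frac{w}{1-\lambda\widehat w}\,\mathbf{F}_s+\frac{\widehat w}{1-\lambda\widehat w}\,\mathbf{F}_s\left(\mathbf{I}_{s\times s}-\lambda\mathbf{K}_s\right),$$ which is upper triangular, and all eigenvalues of $\mathbf{M}(w,\widehat w)$ are equal to $1+\frac{w+\widehat w}{1-\lambda\widehat w}$. In particular, for $\lambda=1$ all eigenvalues equal $\frac{1+w}{1-\widehat w}$, the stability function of the IMEX Euler scheme $y_n=y_{n-1}+h f(y_{n-1})+h g(y_n)$, independently of $s$ and of the abscissae. Moreover, for $\lambda=1$ and $s>1$, the constrained nonstiff stability region is $$\mathcal{S}_\alpha=\mathcal{S}=\left\{w\in\mathbb{C}:\ |1+w|<1\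 \text{ or }\ w=0\right\}.$$
   Context: Notation. $\mathbf{K}_n\in\mathbb{R}^{n\times n}$ has ones on the first superdiagonal and zeros elsewhere. $\mathbf{F}_n\in\mathbb{R}^{n\times n}$ is upper triangular with entries $(\mathbf{F}_n)_{i,j}=\frac{1}{(j-i+1)!}$ for $j\ge i$. $\mathbf{C}_s=\left[\mathbf{1}_s\ \ \mathbf{c}\ \ \tfrac{\mathbf{c}^2}{2}\ \cdots\ \tfrac{\mathbf{c}^{s-1}}{(s-1)!}\right]\in\mathbb{R}^{s\times s}$, with $\mathbf{c}=(c_1,\dots,c_s)^T$, component-wise powers and $\mathbf{1}_s$ the vector of ones. An IMEX general linear method with coefficient matrices $\mathbf{A},\widehat{\mathbf{A}},\mathbf{B},\widehat{\mathbf{B}},\mathbf{U},\mathbf{V}$ applied with step $h$ to the linear test problem $y'=\xi y+\widehat\xi y$ ($\xi y$ treated explicitly, $\widehat\xi y$ implicitly), with $w=h\xi$, $\widehat w=h\widehat\xi$, gives $y^{[n]}=\mathbf{M}(w,\widehat w)\,y^{[n-1]}$ for the vector of external stages, with stability matrix $$\mathbf{M}(w,\widehat w)=\mathbf{V}+\left(w\mathbf{B}+\widehat w\widehat{\mathbf{B}}\right)\left(\mathbf{I}_{s\times s}-w\mathbf{A}-\widehat w\widehat{\mathbf{A}}\right)^{-1}\mathbf{U}.$$ A matrix is power bounded if its powers form a bounded sequence. The stability region of the explicit base method is $\mathcal{S}=\{w\in\mathbb{C}:\mathbf{M}(w,0)\text{ power bounded}\}$; that of the implicit base method is $\widehat{\mathcal{S}}=\{\widehat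 w\in\mathbb{C}:\mathbf{M}(0,\widehat w)\text{ is defined and power bounded}\}$. For an angle $\alpha\in[0,\pi/2]$, the desired stiff stability region and the constrained nonstiff stability region are $$\widehat{\mathcal{S}}_\alpha=\{\widehat w\in\widehat{\mathcal{S}}:|\mathrm{Im}\,\widehat w|<\tan(\alpha)\,|\mathrm{Re}\,\widehat w|\},\qquad \mathcal{S}_\alpha=\{w\in\mathcal{S}:\mathbf{M}(w,\widehat w)\text{ power bounded for all }\widehat w\in\widehat{\mathcal{S}}_\alpha\},$$ where for $\alpha=\pi/2$ the inequality is read as $\mathrm{Re}\,\widehat w\neq 0$. *)

theory Defs
  imports Complex_Main "Jordan_Normal_Form.Spectral_Radius"
begin

text \<open>Rows and columns are indexed from 0, so the entry in row \<open>i + 1\<close> and column \<open>j + 1\<close>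
  of a matrix is \<open>$$ (i, j)\<close>; the defining formulas depend on \<open>j - i\<close> only, except for
  \<open>C_mat\<close>, whose column \<open>j\<close> (from 0) is \<open>c^j / j!\<close>.\<close>

definition K_mat :: "nat \<Rightarrow> real mat" where
  "K_mat n = mat n n (\<lambda>(i, j). if j = i + 1 then 1 else 0)"

definition F_mat :: "nat \<Rightarrow> real mat" where
  "F_mat n = mat n n (\<lambda>(i, j). if i \<le> j then 1 / fact (j - i + 1) else 0)"

definition C_mat :: "nat \<Rightarrow> real vec \<Rightarrow> real mat" where
  "C_mat s c = mat s s (\<lambda>(i, j). (c $ i) ^ j / fact j)"

text \<open>\<open>mat_inv A\<close> is unspecified if \<open>A\<close> is not invertible, so its uses are
  accompanied by \<open>invertible_mat\<close>.\<close>

definition mat_inv :: "'a :: field mat \<Rightarrow> 'a mat" where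
  "mat_inv A = the (mat_inverse A)"

abbreviation cmat :: "real mat \<Rightarrow> complex mat" where
  "cmat \<equiv> map_mat complex_of_real"

text \<open>The primed fields are the hatted (implicit) coefficients.\<close>

record imex_glm =
  coef_A :: "real mat"
  coef_A' :: "real mat"
  coef_B :: "real mat"
  coef_B' :: "real mat"
  coef_U :: "real mat"
  coef_V :: "real mat"

definition stage_mat :: "imex_glm \<Rightarrow> complex \<Rightarrow> complex \<Rightarrow> complex mat" where
  "stage_mat G w w' =
     1\<^sub>m (dim_row (coef_A G)) - w \<cdot>\<^sub>m cmat (coef_A G) - w' \<cdot>\<^sub>m cmat (coef_A' G)"

definition stability_mat_defined :: "imex_glm \<Rightarrow> complex \<Rightarrow> complex \<Rightarrow> bool" where
  "stability_mat_defined G w w' \<longleftrightarrow> invertible_mat (stage_mat G w w')"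

definition stability_mat :: "imex_glm \<Rightarrow> complex \<Rightarrow> complex \<Rightarrow> complex mat" where
  "stability_mat G w w' =
     cmat (coef_V G)
     + (w \<cdot>\<^sub>m cmat (coef_B G) + w' \<cdot>\<^sub>m cmat (coef_B' G))
       * mat_inv (stage_mat G w w') * cmat (coef_U G)"

definition power_bounded :: "complex mat \<Rightarrow> bool" where
  "power_bounded M \<longleftrightarrow> (\<exists>b. \<forall>k. norm_bound (M ^\<^sub>m k) b)"

definition stable_at :: "imex_glm \<Rightarrow> complex \<Rightarrow> complex \<Rightarrow> bool" where
  "stable_at G w w' \<longleftrightarrow>
     stability_mat_defined G w w' \<and> power_bounded (stability_mat G w w')"

definition explicit_region :: "imex_glm \<Rightarrow> complex set" where
  "explicit_region G = {w. stable_at G w 0}"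

definition implicit_region :: "imex_glm \<Rightarrow> complex set" where
  "implicit_region G = {w'. stable_at G 0 w'}"

text \<open>The case distinction is needed since \<open>tan (pi / 2) = 0\<close> in HOL.\<close>

definition in_sector :: "real \<Rightarrow> complex \<Rightarrow> bool" where
  "in_sector \<alpha> z \<longleftrightarrow>
     (if \<alpha> = pi / 2 then Re z \<noteq> 0 else \<bar>Im z\<bar> < tan \<alpha> * \<bar>Re z\<bar>)"

definition stiff_region :: "imex_glm \<Rightarrow> real \<Rightarrow> complex set" where
  "stiff_region G \<alpha> = {w' \<in> implicit_region G. in_sector \<alpha> w'}"

definition nonstiff_region :: "imex_glm \<Rightarrow> real \<Rightarrow> complex set" where
  "nonstiff_region G \<alpha> =
     {w \<in> explicit_region G. \<forall>w' \<in> stiff_region G \<alpha>. stable_at G w w'}"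

definition ensemble_euler :: "nat \<Rightarrow> real vec \<Rightarrow> real \<Rightarrow> imex_glm" where
  "ensemble_euler s c lam =
     \<lparr> coef_A = 0\<^sub>m s s,
       coef_A' = lam \<cdot>\<^sub>m 1\<^sub>m s,
       coef_B = C_mat s c * F_mat s * mat_inv (C_mat s c),
       coef_B' = C_mat s c * F_mat s * (1\<^sub>m s - lam \<cdot>\<^sub>m K_mat s) * mat_inv (C_mat s c),
       coef_U = 1\<^sub>m s,
       coef_V = 1\<^sub>m s \<rparr>"

definition imex_euler_step ::
  "real \<Rightarrow> (complex \<Rightarrow> complex) \<Rightarrow> (complex \<Rightarrow> complex) \<Rightarrow> complex \<Rightarrow> complex \<Rightarrow> bool" where
  "imex_euler_step h f g y y' \<longleftrightarrow> y' = y + of_real h * f y + of_real h * g y'"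

end

theory Submission
  imports Defs
begin

text \<open>Conjugation by \<open>C_mat s c\<close>, a scaled Vandermonde matrix and hence invertible, turns the
  stability matrix into an upper triangular matrix with constant diagonal \<open>a\<close>. Such a matrix is
  power bounded if \<open>\<bar>a\<bar> < 1\<close>. If \<open>\<bar>a\<bar> \<ge> 1\<close> and the first superdiagonal entry \<open>b\<close> is nonzero,
  then the entry \<open>k a\<^sup>k\<^sup>-\<^sup>1 b\<close> of the \<open>k\<close>-th power is unbounded. For \<open>\<lambda> = 1\<close> one has
  \<open>a = (1 + w) / (1 - w')\<close> and \<open>b = (w - w') / (2 (1 - w'))\<close>. The sectors exclude \<open>w' = 0\<close>, so
  every \<open>w'\<close> in the stiff region satisfies \<open>\<bar>1 - w'\<bar> > 1\<close>, and damps every stable \<open>w\<close>.\<close>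

section \<open>Matrix inverses and the scaled Vandermonde matrix\<close>

lemma mat_inv_eqI:
  fixes A B :: "'a :: field mat"
  assumes A: "A \<in> carrier_mat n n" and B: "B \<in> carrier_mat n n"
    and AB: "A * B = 1\<^sub>m n" and BA: "B * A = 1\<^sub>m n"
  shows "mat_inv A = B"
proof -
  have "A \<in> Units (ring_mat TYPE('a) n ())"
    unfolding Units_def ring_mat_def using A B AB BA by auto
  then obtain X where X: "mat_inverse A = Some X"
    using mat_inverse(1)[OF A, of "()"] by (cases "mat_inverse A") auto
  then have AX: "A * X = 1\<^sub>m n" and Xc: "X \<in> carrier_mat n n"
    using mat_inverse(2)[OF A X] by auto
  have "X = (B * A) * X" using Xc BA by simp
  also have "\<dots> = B * (A * X)" using A B Xc by simp
  also have "\<dots> = B" using AX B by simp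
  finally show ?thesis by (simp add: mat_inv_def X)
qed

lemma mat_inv_det_nonzero:
  fixes A :: "'a :: field mat"
  assumes A: "A \<in> carrier_mat n n" and d: "det A \<noteq> 0"
  shows "mat_inv A \<in> carrier_mat n n" "A * mat_inv A = 1\<^sub>m n" "mat_inv A * A = 1\<^sub>m n"
proof -
  obtain B where B: "B \<in> carrier_mat n n" "A * B = 1\<^sub>m n" "B * A = 1\<^sub>m n"
    using det_non_zero_imp_unit[OF A d, of "()"] unfolding Units_def ring_mat_def by auto
  then have "mat_inv A = B" using mat_inv_eqI[OF A] by blast
  with B show "mat_inv A \<in> carrier_mat n n" "A * mat_inv A = 1\<^sub>m n" "mat_inv A * A = 1\<^sub>m n"
    by simp_all
qed

lemma invertible_matI:
  assumes "A \<in> carrier_mat n n" "B \<in> carrier_mat n n" "A * B = 1\<^sub>m n" "B * A = 1\<^sub>m n"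
  shows "invertible_mat A"
  unfolding invertible_mat_def inverts_mat_def using assms by auto

text \<open>Up to the factorials, a kernel vector \<open>v\<close> lists the coefficients of a
  polynomial of degree below \<open>s\<close> that vanishes at \<open>s\<close> distinct abscissae.
  Such a polynomial is zero, hence so is \<open>v\<close>.\<close>

lemma det_C_mat_nonzero:
  assumes inj: "inj_on (\<lambda>i. c $ i) {..<s}"
  shows "det (C_mat s c) \<noteq> 0"
proof
  have C: "C_mat s c \<in> carrier_mat s s" by (simp add: C_mat_def)
  assume "det (C_mat s c) = 0"
  then obtain v where v: "v \<in> carrier_vec s" "v \<noteq> 0\<^sub>v s" "C_mat s c *\<^sub>v v = 0\<^sub>v s"
    using det_0_iff_vec_prod_zero[OF C] by blast
  define p where "p = (\<Sum>j<s. monom (v $ j / fact j) j)"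
  have coeff: "coeff p j = (if j < s then v $ j / fact j else 0)" for j
    by (simp add: p_def coeff_sum sum.delta)
  have root: "poly p (c $ i) = 0" if i: "i < s" for i
  proof -
    have "(C_mat s c *\<^sub>v v) $ i = poly p (c $ i)"
      using i v(1) C
      by (simp add: p_def poly_sum poly_monom scalar_prod_def C_mat_def atLeast0LessThan mult_ac)
    with i v(3) show ?thesis by simp
  qed
  have "p = 0"
  proof (rule ccontr)
    assume p: "p \<noteq> 0"
    \<comment> \<open>The nonzero entry serves to get \<open>0 < s\<close>: at \<open>s = 0\<close>,
      truncated subtraction makes \<open>s - 1 = s\<close>, and the two bounds on
      \<open>degree p\<close> would not clash.\<close>
    obtain j where j: "j < s" "v $ j \<noteq> 0"
      using v(1,2) by (metis carrier_vecD eq_vecI index_zero_vec)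
    then have s: "0 < s" by simp
    have "degree p \<le> s - 1"
      by (rule degree_le) (auto simp: coeff)
    have "s = card ((\<lambda>i. c $ i) ` {..<s})"
      using inj by (simp add: card_image)
    also have "\<dots> \<le> card {x. poly p x = 0}"
      by (rule card_mono[OF poly_roots_finite[OF p]]) (auto simp: root)
    also have "\<dots> \<le> degree p"
      by (rule card_poly_roots_bound[OF p])
    finally show False using \<open>degree p \<le> s - 1\<close> s by simp
  qed
  have "v = 0\<^sub>v s"
  proof (rule eq_vecI)
    fix i assume "i < dim_vec (0\<^sub>v s :: real vec)"
    then show "v $ i = 0\<^sub>v s $ i" using coeff[of i] \<open>p = 0\<close> by simp
  qed (use v in simp)
  with v show False by simp
qed

section \<open>Spectra, similarity and power boundedness\<close>

lemma spectrum_upper_triangular: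
  fixes A :: "'a :: field mat"
  assumes A: "A \<in> carrier_mat n n" and ut: "upper_triangular A"
  shows "spectrum A = (\<lambda>i. A $$ (i, i)) ` {..<n}"
  unfolding spectrum_root_char_poly[OF A] char_poly_upper_triangular[OF A ut] diag_mat_def
  using A by (auto simp: poly_prod_list prod_list_zero_iff)

lemma spectrum_similar_mat_wit:
  fixes A :: "'a :: field mat"
  assumes "similar_mat_wit A B P Q"
  shows "spectrum A = spectrum B"
proof -
  have "similar_mat A B" using assms unfolding similar_mat_def by blast
  then have "char_poly A = char_poly B" by (rule char_poly_similar)
  note D = similar_mat_witD[OF refl assms]
  show ?thesis
    unfolding spectrum_root_char_poly[OF D(4)] spectrum_root_char_poly[OF D(5)]
      \<open>char_poly A = char_poly B\<close> ..
qed

text \<open>The k-th power of \<open>A\<close> is the k-th power of \<open>B\<close> between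
  \<open>P\<close> and \<open>Q\<close>, which do not depend on k. Each of the two products costs a
  factor \<open>n\<close>, the number of summands in an entry.\<close>

lemma power_bounded_similar_mat_wit:
  assumes sim: "similar_mat_wit A B P Q" and pb: "power_bounded B"
  shows "power_bounded A"
proof -
  define n where "n = dim_row A"
  note D = similar_mat_witD[OF n_def sim]
  obtain b where b: "norm_bound (B ^\<^sub>m k) b" for k
    using pb unfolding power_bounded_def by blast
  obtain p where p: "norm_bound P p" using norm_bound_max by blast
  obtain q where q: "norm_bound Q q" using norm_bound_max by blast
  have "norm_bound (A ^\<^sub>m k) (p * b * of_nat n * q * of_nat n)" for k
  proof -
    have Bk: "B ^\<^sub>m k \<in> carrier_mat n n" using D by simp
    have "norm_bound (P * B ^\<^sub>m k) (p * b * of_nat n)"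
      by (rule norm_bound_mult[OF D(6) Bk p b])
    then have "norm_bound (P * B ^\<^sub>m k * Q) (p * b * of_nat n * q * of_nat n)"
      by (rule norm_bound_mult[OF mult_carrier_mat[OF D(6) Bk] D(7) _ q])
    then show ?thesis using similar_mat_wit_pow_id[OF sim] by simp
  qed
  then show ?thesis unfolding power_bounded_def by blast
qed

text \<open>The spectral radius is \<open>cmod a\<close>; below 1, geometric decay beats the
  polynomial growth in powers of Jordan blocks.\<close>

lemma power_bounded_spectrum:
  assumes A: "A \<in> carrier_mat n n" and n: "0 < n" and sp: "spectrum A = {a}" and a: "cmod a < 1"
  shows "power_bounded A"
  unfolding power_bounded_def
  by (rule spectral_radius_jnf_norm_bound_less_1_upper_triangular[OF A])
    (simp add: spectral_radius_def sp a)

text \<open>Multiplying by an upper triangular matrix on the right, column \<open>j\<close> of the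
  new power depends only on columns up to \<open>j\<close> of the old one. So the leading 2 by 2
  block evolves on its own, like a Jordan block with superdiagonal entry
  \<open>A $$ (0, 1)\<close>.\<close>

lemma pow_upper_triangular_first_row:
  fixes A :: "'a :: comm_ring_1 mat"
  assumes A: "A \<in> carrier_mat n n" and ut: "upper_triangular A" and n: "1 < n"
    and d: "A $$ (0, 0) = a" "A $$ (1, 1) = a"
  shows "(A ^\<^sub>m k) $$ (0, 0) = a ^ k
    \<and> (A ^\<^sub>m Suc k) $$ (0, 1) = of_nat (Suc k) * a ^ k * A $$ (0, 1)"
proof -
  have low: "A $$ (i, j) = 0" if "j < i" "i < n" for i j
    using upper_triangularD[OF ut, of j i] that A by auto
  have entry: "(A ^\<^sub>m Suc k) $$ (0, j) = (\<Sum>i\<in>{..j}. (A ^\<^sub>m k) $$ (0, i) * A $$ (i, j))"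
    if "j < n" for j k
  proof -
    have "(A ^\<^sub>m Suc k) $$ (0, j) = (\<Sum>i<n. (A ^\<^sub>m k) $$ (0, i) * A $$ (i, j))"
      using that A n by (simp add: scalar_prod_def atLeast0LessThan)
    also have "\<dots> = (\<Sum>i\<in>{..j}. (A ^\<^sub>m k) $$ (0, i) * A $$ (i, j))"
      by (rule sum.mono_neutral_right) (use that low in auto)
    finally show ?thesis .
  qed
  have 0: "(A ^\<^sub>m k) $$ (0, 0) = a ^ k" for k
  proof (induction k)
    case 0
    then show ?case using A n by simp
  next
    case (Suc k)
    then show ?case using entry[of 0 k] n d by (simp del: pow_mat.simps add: mult.commute)
  qed
  \<comment> \<open>A linear recurrence for the superdiagonal entry, started from 0 at the identity
    matrix.\<close>
  have split: "(A ^\<^sub>m Suc k) $$ (0, 1) = a ^ k * A $$ (0, 1) + (A ^\<^sub>m k) $$ (0, 1) * a" for k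
    using entry[of 1 k] n d 0 by (simp del: pow_mat.simps)
  have "(A ^\<^sub>m Suc k) $$ (0, 1) = of_nat (Suc k) * a ^ k * A $$ (0, 1)"
  proof (induction k)
    case 0
    then show ?case using split[of 0] A n by (simp del: pow_mat.simps add: pow_mat.simps(1))
  next
    case (Suc k)
    then show ?case using split[of "Suc k"] by (simp del: pow_mat.simps add: algebra_simps)
  qed
  with 0 show ?thesis by blast
qed

lemma not_power_bounded_upper_triangular:
  assumes A: "A \<in> carrier_mat n n" and ut: "upper_triangular A" and n: "1 < n"
    and d: "A $$ (0, 0) = a" "A $$ (1, 1) = a"
    and a: "1 \<le> cmod a" and b: "A $$ (0, 1) \<noteq> 0"
  shows "\<not> power_bounded A"
proof
  assume "power_bounded A"
  then obtain r where r: "norm_bound (A ^\<^sub>m k) r" for k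
    unfolding power_bounded_def by blast
  \<comment> \<open>Linear growth alone overtakes \<open>r\<close>; the factor
    \<open>cmod a ^ k\<close>, at least 1, can only help. The violated bound is that of power
    \<open>Suc k\<close>.\<close>
  obtain k where k: "r < real k * cmod (A $$ (0, 1))"
    using reals_Archimedean3[of "cmod (A $$ (0, 1))"] b by auto
  have "real k * cmod (A $$ (0, 1)) \<le> real (Suc k) * cmod a ^ k * cmod (A $$ (0, 1))"
  proof (rule mult_right_mono)
    have "real k * 1 \<le> real (Suc k) * cmod a ^ k"
      by (intro mult_mono) (use a in \<open>auto intro: one_le_power\<close>)
    then show "real k \<le> real (Suc k) * cmod a ^ k" by simp
  qed simp
  also have "\<dots> = cmod ((A ^\<^sub>m Suc k) $$ (0, 1))"
    unfolding conjunct2[OF pow_upper_triangular_first_row[OF A ut n d]] norm_mult norm_power norm_of_nat ..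
  also have "\<dots> \<le> r"
    using r[of "Suc k"] A n unfolding norm_bound_def by (simp del: pow_mat.simps)
  finally show False using k by simp
qed

section \<open>The triangular form of the stability matrix\<close>

definition euler_triangle :: "nat \<Rightarrow> real \<Rightarrow> complex \<Rightarrow> complex \<Rightarrow> complex mat" where
  "euler_triangle s lam w w' = 1\<^sub>m s
     + (w / (1 - of_real lam * w')) \<cdot>\<^sub>m cmat (F_mat s)
     + (w' / (1 - of_real lam * w')) \<cdot>\<^sub>m cmat (F_mat s * (1\<^sub>m s - lam \<cdot>\<^sub>m K_mat s))"

text \<open>Right multiplication by \<open>K_mat s\<close> shifts the columns one place to the right
  and fills column 0 with zeros.\<close>

lemma F_mat_mult_entry:
  assumes "i < s" "j < s"
  shows "(F_mat s * (1\<^sub>m s - lam \<cdot>\<^sub>m K_mat s)) $$ (i, j) =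
    F_mat s $$ (i, j) - (if j = 0 then 0 else lam * F_mat s $$ (i, j - 1))"
proof -
  have "(F_mat s * (1\<^sub>m s - lam \<cdot>\<^sub>m K_mat s)) $$ (i, j) =
    (\<Sum>k<s. F_mat s $$ (i, k) * ((if k = j then 1 else 0) - lam * (if j = k + 1 then 1 else 0)))"
    using assms by (simp add: F_mat_def K_mat_def scalar_prod_def atLeast0LessThan)
  \<comment> \<open>Without the guard \<open>j \<noteq> 0\<close>, truncation would turn
    \<open>j - 1\<close> into 0 for \<open>j = 0\<close> and select a spurious term.\<close>
  also have "\<dots> = (\<Sum>k<s. (if k = j then F_mat s $$ (i, k) else 0)
      - (if j \<noteq> 0 \<and> k = j - 1 then lam * F_mat s $$ (i, k) else 0))"
    by (rule sum.cong) auto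
  also have "\<dots> = F_mat s $$ (i, j) - (if j = 0 then 0 else lam * F_mat s $$ (i, j - 1))"
    using assms by (auto simp: sum_subtractf)
  finally show ?thesis .
qed

lemma euler_triangle_carrier: "euler_triangle s lam w w' \<in> carrier_mat s s"
proof -
  have "F_mat s * (1\<^sub>m s - lam \<cdot>\<^sub>m K_mat s) \<in> carrier_mat s s"
    by (rule mult_carrier_mat[of _ s s]) (auto simp: F_mat_def K_mat_def)
  then show ?thesis unfolding euler_triangle_def by (intro add_carrier_mat) auto
qed

lemma euler_triangle_entry:
  assumes "i < s" "j < s"
  shows "euler_triangle s lam w w' $$ (i, j) = (if i = j then 1 else 0)
    + w / (1 - of_real lam * w') * of_real (F_mat s $$ (i, j))
    + w' / (1 - of_real lam * w') *
      of_real (F_mat s $$ (i, j) - (if j = 0 then 0 else lam * F_mat s $$ (i, j - 1)))"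
proof -
  have dims: "F_mat s \<in> carrier_mat s s" "K_mat s \<in> carrier_mat s s"
    by (simp_all add: F_mat_def K_mat_def)
  have "F_mat s * (1\<^sub>m s - lam \<cdot>\<^sub>m K_mat s) \<in> carrier_mat s s" using dims by auto
  then have "cmat (F_mat s * (1\<^sub>m s - lam \<cdot>\<^sub>m K_mat s)) $$ (i, j) =
    of_real (F_mat s $$ (i, j) - (if j = 0 then 0 else lam * F_mat s $$ (i, j - 1)))"
    using assms F_mat_mult_entry[OF assms, of lam] by (subst index_map_mat) auto
  then show ?thesis
    using assms dims by (simp add: euler_triangle_def del: index_mult_mat(1))
qed

lemma euler_triangle_upper_triangular: "upper_triangular (euler_triangle s lam w w')"
proof
  fix i j assume "j < i" "i < dim_row (euler_triangle s lam w w')"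
  then show "euler_triangle s lam w w' $$ (i, j) = 0"
    using euler_triangle_carrier[of s lam w w'] by (auto simp: euler_triangle_entry F_mat_def)
qed

text \<open>The diagonal of \<open>F_mat s\<close> is 1, and the shifted entry comes from below the
  diagonal, so \<open>lam\<close> survives only in the denominator.\<close>

lemma euler_triangle_diag:
  assumes "i < s"
  shows "euler_triangle s lam w w' $$ (i, i) = 1 + (w + w') / (1 - of_real lam * w')"
  using assms by (auto simp: euler_triangle_entry F_mat_def add_divide_distrib)

text \<open>Here \<open>F_mat\<close> contributes 1/2 and the shifted entry is the diagonal 1, so
  \<open>w'\<close> gets the coefficient 1/2 - 1. The entry vanishes only for \<open>w = w'\<close>,
  the exceptional case in the instability argument.\<close>

lemma euler_triangle_superdiag:
  assumes "1 < s"
  shows "euler_triangle s 1 w w' $$ (0, Suc 0) = (w - w') / (2 * (1 - w'))"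
  using assms by (simp add: euler_triangle_entry F_mat_def diff_divide_distrib mult.commute)

lemma stage_mat_ensemble_euler:
  "stage_mat (ensemble_euler s c lam) w w' = (1 - of_real lam * w') \<cdot>\<^sub>m 1\<^sub>m s"
  by (rule eq_matI) (auto simp: stage_mat_def ensemble_euler_def)

text \<open>The stage matrix is scalar. Invertibility forces a nonzero scalar by comparing entries
  (0, 0), which exist because \<open>s \<ge> 1\<close>; an empty matrix would be invertible for any
  scalar.\<close>

lemma stability_mat_defined_ensemble_euler:
  assumes "s \<ge> 1"
  shows "stability_mat_defined (ensemble_euler s c lam) w w' \<longleftrightarrow> 1 - of_real lam * w' \<noteq> 0"
proof
  assume "stability_mat_defined (ensemble_euler s c lam) w w'"
  then obtain B where "((1 - of_real lam * w') \<cdot>\<^sub>m 1\<^sub>m s) * B = 1\<^sub>m s"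
    and B: "B * ((1 - of_real lam * w') \<cdot>\<^sub>m 1\<^sub>m s) = 1\<^sub>m (dim_row B)"
    unfolding stability_mat_defined_def stage_mat_ensemble_euler invertible_mat_def inverts_mat_def
    by auto
  \<comment> \<open>\<open>invertible_mat\<close> does not fix the shape of the inverse, so it is
    read off from the two product equations.\<close>
  have "dim_row B = s" using arg_cong[OF B, of dim_col] by simp
  moreover have "dim_col B = s"
    using arg_cong[OF \<open>((1 - of_real lam * w') \<cdot>\<^sub>m 1\<^sub>m s) * B = 1\<^sub>m s\<close>, of dim_col] by simp
  ultimately have Bc: "B \<in> carrier_mat s s" by auto
  have "B * ((1 - of_real lam * w') \<cdot>\<^sub>m 1\<^sub>m s) = (1 - of_real lam * w') \<cdot>\<^sub>m B"
    using Bc by (simp add: mult_smult_distrib[of _ s s _ s])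
  with B \<open>dim_row B = s\<close> have "(1 - of_real lam * w') \<cdot>\<^sub>m B = 1\<^sub>m s" by simp
  from arg_cong[OF this, of "\<lambda>A. A $$ (0, 0)"] show "1 - of_real lam * w' \<noteq> 0"
    using Bc assms by auto
next
  assume d: "1 - of_real lam * w' \<noteq> 0"
  show "stability_mat_defined (ensemble_euler s c lam) w w'"
    unfolding stability_mat_defined_def stage_mat_ensemble_euler
    by (rule invertible_matI[of _ s "(1 / (1 - of_real lam * w')) \<cdot>\<^sub>m 1\<^sub>m s"])
      (use d in \<open>auto simp: mult_smult_distrib[of _ s s _ s] mult_smult_assoc_mat[of _ s s _ s]
         intro!: eq_matI\<close>)
qed

text \<open>The inverse of the scalar stage matrix is a scalar factor, and both B-coefficients are
  conjugates by \<open>C_mat s c\<close>. A similarity witness records this in a form that transfers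
  spectra, and boundedness in both directions.\<close>

lemma stability_mat_ensemble_euler:
  fixes c :: "real vec"
  assumes inj: "inj_on (\<lambda>i. c $ i) {..<s}" and d: "1 - of_real lam * w' \<noteq> 0"
  shows "similar_mat_wit (stability_mat (ensemble_euler s c lam) w w') (euler_triangle s lam w w')
    (cmat (C_mat s c)) (cmat (mat_inv (C_mat s c)))"
proof -
  define e where "e = 1 - of_real lam * w'"
  have C: "C_mat s c \<in> carrier_mat s s" by (simp add: C_mat_def)
  note inv = mat_inv_det_nonzero[OF C det_C_mat_nonzero[OF inj]]
  define G where "G = F_mat s * (1\<^sub>m s - lam \<cdot>\<^sub>m K_mat s)"
  have F: "F_mat s \<in> carrier_mat s s" and K: "K_mat s \<in> carrier_mat s s"
    by (simp_all add: F_mat_def K_mat_def)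
  have G: "G \<in> carrier_mat s s" using F K by (auto simp: G_def)
  define P Q where "P = cmat (C_mat s c)" and "Q = cmat (mat_inv (C_mat s c))"
  define F' G' where "F' = cmat (F_mat s)" and "G' = cmat G"
  have carr: "P \<in> carrier_mat s s" "Q \<in> carrier_mat s s" "F' \<in> carrier_mat s s" "G' \<in> carrier_mat s s"
    using C inv(1) F G by (auto simp: P_def Q_def F'_def G'_def)
  \<comment> \<open>The inverse is taken over the reals; the entrywise embedding into complex
    matrices preserves products and the identity.\<close>
  have PQ: "P * Q = 1\<^sub>m s" and QP: "Q * P = 1\<^sub>m s"
    using inv C by (simp_all add: P_def Q_def of_real_hom.mat_hom_mult[symmetric] of_real_hom.mat_hom_one)
  have conj: "cmat (C_mat s c * X * mat_inv (C_mat s c)) = P * cmat X * Q"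
    if "X \<in> carrier_mat s s" for X
    using that C inv(1) by (simp add: P_def Q_def of_real_hom.mat_hom_mult[of _ s s _ s])
  have "C_mat s c * F_mat s * (1\<^sub>m s - lam \<cdot>\<^sub>m K_mat s) = C_mat s c * G"
    unfolding G_def using C F K by (intro assoc_mult_mat) auto
  then have B': "cmat (coef_B' (ensemble_euler s c lam)) = P * G' * Q"
    using conj[OF G] by (simp add: ensemble_euler_def G'_def)
  have B: "cmat (coef_B (ensemble_euler s c lam)) = P * F' * Q"
    using conj[OF F] by (simp add: ensemble_euler_def F'_def)
  have S: "mat_inv (stage_mat (ensemble_euler s c lam) w w') = (1 / e) \<cdot>\<^sub>m 1\<^sub>m s"
    unfolding stage_mat_ensemble_euler
    by (rule mat_inv_eqI[of _ s])
      (use d in \<open>auto simp: e_def mult_smult_distrib[of _ s s _ s] mult_smult_assoc_mat[of _ s s _ s]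
         intro!: eq_matI\<close>)
  have UV: "cmat (coef_U (ensemble_euler s c lam)) = 1\<^sub>m s"
      "cmat (coef_V (ensemble_euler s c lam)) = 1\<^sub>m s"
    by (simp_all add: ensemble_euler_def of_real_hom.mat_hom_one)
  have PFQ: "P * F' * Q \<in> carrier_mat s s" and PGQ: "P * G' * Q \<in> carrier_mat s s"
    using carr by auto
  have M: "stability_mat (ensemble_euler s c lam) w w' =
    1\<^sub>m s + (w \<cdot>\<^sub>m (P * F' * Q) + w' \<cdot>\<^sub>m (P * G' * Q)) * ((1 / e) \<cdot>\<^sub>m 1\<^sub>m s) * 1\<^sub>m s"
    unfolding stability_mat_def UV B B' S ..
  also have "(w \<cdot>\<^sub>m (P * F' * Q) + w' \<cdot>\<^sub>m (P * G' * Q)) * ((1 / e) \<cdot>\<^sub>m 1\<^sub>m s) * 1\<^sub>m s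
    = (1 / e) \<cdot>\<^sub>m (w \<cdot>\<^sub>m (P * F' * Q) + w' \<cdot>\<^sub>m (P * G' * Q))"
    using PFQ PGQ by (simp add: mult_smult_distrib[of _ s s _ s] right_mult_one_mat[of _ s s])
  also have "\<dots> = (w / e) \<cdot>\<^sub>m (P * F' * Q) + (w' / e) \<cdot>\<^sub>m (P * G' * Q)"
    by (rule eq_matI) (use carr in \<open>auto simp: add_divide_distrib simp del: index_mult_mat(1)\<close>)
  also have "1\<^sub>m s + \<dots> = 1\<^sub>m s + (w / e) \<cdot>\<^sub>m (P * F' * Q) + (w' / e) \<cdot>\<^sub>m (P * G' * Q)"
    using PFQ PGQ by (intro assoc_add_mat[symmetric, of _ s s]) auto
  \<comment> \<open>Expanding the right-hand side turns the summand for the identity into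
    \<open>P * Q\<close>, which is the identity again.\<close>
  also have "\<dots> = P * (1\<^sub>m s + (w / e) \<cdot>\<^sub>m F' + (w' / e) \<cdot>\<^sub>m G') * Q"
    using carr PQ
    by (simp add: add_mult_distrib_mat[of _ s s _ _ s] mult_add_distrib_mat[of _ s s _ s] assoc_add_mat[of _ s s]
        mult_smult_distrib[of _ s s _ s] mult_smult_assoc_mat[of _ s s _ s])
  also have "1\<^sub>m s + (w / e) \<cdot>\<^sub>m F' + (w' / e) \<cdot>\<^sub>m G' = euler_triangle s lam w w'"
    by (simp add: euler_triangle_def e_def F'_def G'_def G_def)
  finally have M': "stability_mat (ensemble_euler s c lam) w w' = P * euler_triangle s lam w w' * Q" .
  show ?thesis
    unfolding P_def[symmetric] Q_def[symmetric]
    by (rule similar_mat_witI[OF PQ QP M'])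
      (use carr euler_triangle_carrier
        mult_carrier_mat[OF mult_carrier_mat[OF carr(1) euler_triangle_carrier] carr(2)]
       in \<open>simp_all add: M'\<close>)
qed

section \<open>Eigenvalues and stability regions\<close>

lemma spectrum_ensemble_euler:
  fixes c :: "real vec"
  assumes s: "s \<ge> 1" and inj: "inj_on (\<lambda>i. c $ i) {..<s}" and d: "1 - of_real lam * w' \<noteq> 0"
  shows "spectrum (stability_mat (ensemble_euler s c lam) w w') = {1 + (w + w') / (1 - of_real lam * w')}"
proof -
  have "spectrum (stability_mat (ensemble_euler s c lam) w w') = spectrum (euler_triangle s lam w w')"
    by (rule spectrum_similar_mat_wit[OF stability_mat_ensemble_euler[OF inj d]])
  also have "\<dots> = (\<lambda>i. euler_triangle s lam w w' $$ (i, i)) ` {..<s}"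
    by (rule spectrum_upper_triangular[OF euler_triangle_carrier euler_triangle_upper_triangular])
  also have "\<dots> = (\<lambda>i. 1 + (w + w') / (1 - of_real lam * w')) ` {..<s}"
    by (rule image_cong) (auto simp: euler_triangle_diag)
  \<comment> \<open>The image is a singleton because the index set is nonempty by
    \<open>s \<ge> 1\<close>.\<close>
  also have "\<dots> = {1 + (w + w') / (1 - of_real lam * w')}"
    using s by (simp add: image_constant_conv lessThan_empty_iff)
  finally show ?thesis .
qed

lemma imex_euler_eigenvalue:
  fixes w w' :: complex
  assumes "1 - w' \<noteq> 0"
  shows "1 + (w + w') / (1 - w') = (1 + w) / (1 - w')"
  using assms by (simp add: field_simps)

text \<open>The strict inequality yields both \<open>1 - w' \<noteq> 0\<close> and an eigenvalue of
  modulus below 1.\<close>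

lemma stable_at_ensemble_euler:
  fixes c :: "real vec"
  assumes s: "s \<ge> 1" and inj: "inj_on (\<lambda>i. c $ i) {..<s}" and w: "cmod (1 + w) < cmod (1 - w')"
  shows "stable_at (ensemble_euler s c 1) w w'"
proof -
  have "0 < cmod (1 - w')" using w norm_ge_zero[of "1 + w"] by linarith
  then have "1 - w' \<noteq> 0" by simp
  then have d: "1 - of_real 1 * w' \<noteq> 0" by simp
  note sim = stability_mat_ensemble_euler[OF inj d]
  have carr: "stability_mat (ensemble_euler s c 1) w w' \<in> carrier_mat s s"
    by (rule similar_mat_witD2(5)[OF euler_triangle_carrier similar_mat_wit_sym[OF sim]])
  have "cmod ((1 + w) / (1 - w')) < 1" using w by (simp add: norm_divide divide_simps)
  moreover have "spectrum (stability_mat (ensemble_euler s c 1) w w') = {(1 + w) / (1 - w')}"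
    using spectrum_ensemble_euler[OF s inj d] imex_euler_eigenvalue[OF \<open>1 - w' \<noteq> 0\<close>] by simp
  ultimately have "power_bounded (stability_mat (ensemble_euler s c 1) w w')"
    using power_bounded_spectrum[OF carr] s by simp
  then show ?thesis
    using d unfolding stable_at_def stability_mat_defined_ensemble_euler[OF s] by simp
qed

text \<open>The eigenvalue is 1, beyond the reach of the spectral criterion, but the triangular form
  is the identity.\<close>

lemma stable_at_ensemble_euler_0_0:
  fixes c :: "real vec"
  assumes s: "s \<ge> 1" and inj: "inj_on (\<lambda>i. c $ i) {..<s}"
  shows "stable_at (ensemble_euler s c 1) 0 0"
proof -
  have d: "1 - of_real 1 * (0 :: complex) \<noteq> 0" by simp
  have T: "euler_triangle s 1 0 0 = 1\<^sub>m s"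
    by (rule eq_matI) (use euler_triangle_carrier[of s 1 0 0] in \<open>auto simp: euler_triangle_entry\<close>)
  have "norm_bound ((1\<^sub>m s :: complex mat) ^\<^sub>m k) 1" for k
  proof -
    have "(1\<^sub>m s :: complex mat) ^\<^sub>m k = 1\<^sub>m s" by (induction k) auto
    then show ?thesis by (auto simp: norm_bound_def)
  qed
  then have "power_bounded (1\<^sub>m s)" unfolding power_bounded_def by blast
  then have "power_bounded (stability_mat (ensemble_euler s c 1) 0 0)"
    using power_bounded_similar_mat_wit[OF stability_mat_ensemble_euler[OF inj d, of 0]] T by simp
  then show ?thesis
    unfolding stable_at_def stability_mat_defined_ensemble_euler[OF s] by simp
qed

text \<open>The eigenvalue has modulus at least 1, and for \<open>s > 1\<close> there is a
  superdiagonal entry, nonzero by \<open>w \<noteq> w'\<close>. An undefined stability matrix counts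
  as unstable.\<close>

lemma not_stable_at_ensemble_euler:
  fixes c :: "real vec"
  assumes s: "s > 1" and inj: "inj_on (\<lambda>i. c $ i) {..<s}"
    and w: "cmod (1 - w') \<le> cmod (1 + w)" "w \<noteq> w'"
  shows "\<not> stable_at (ensemble_euler s c 1) w w'"
proof
  assume st: "stable_at (ensemble_euler s c 1) w w'"
  then have d: "1 - of_real 1 * w' \<noteq> 0"
    unfolding stable_at_def using stability_mat_defined_ensemble_euler s by (metis less_imp_le)
  then have d': "1 - w' \<noteq> 0" by simp
  have "power_bounded (euler_triangle s 1 w w')"
    using st similar_mat_wit_sym[OF stability_mat_ensemble_euler[OF inj d]]
    unfolding stable_at_def by (blast intro: power_bounded_similar_mat_wit)
  moreover have "euler_triangle s 1 w w' $$ (i, i) = (1 + w) / (1 - w')" if "i < s" for i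
    using euler_triangle_diag[OF that, of 1 w w'] imex_euler_eigenvalue[OF d'] by simp
  moreover have "1 \<le> cmod ((1 + w) / (1 - w'))"
    using w d' by (simp add: norm_divide divide_simps)
  moreover have "euler_triangle s 1 w w' $$ (0, 1) \<noteq> 0"
    using w d' s by (simp add: euler_triangle_superdiag)
  ultimately show False
    using not_power_bounded_upper_triangular[OF euler_triangle_carrier euler_triangle_upper_triangular s]
      s by simp
qed

lemma explicit_region_ensemble_euler:
  fixes c :: "real vec"
  assumes s: "s > 1" and inj: "inj_on (\<lambda>i. c $ i) {..<s}"
  shows "explicit_region (ensemble_euler s c 1) = {w. cmod (1 + w) < 1 \<or> w = 0}"
proof -
  have "stable_at (ensemble_euler s c 1) w 0 \<longleftrightarrow> cmod (1 + w) < 1 \<or> w = 0" for w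
    using stable_at_ensemble_euler[OF _ inj, of w 0] stable_at_ensemble_euler_0_0[OF _ inj]
      not_stable_at_ensemble_euler[OF s inj, of 0 w] s
    by (cases "w = 0"; cases "cmod (1 + w) < 1") simp_all
  then show ?thesis unfolding explicit_region_def by simp
qed

lemma nonstiff_region_ensemble_euler:
  fixes c :: "real vec"
  assumes s: "s > 1" and inj: "inj_on (\<lambda>i. c $ i) {..<s}"
  shows "nonstiff_region (ensemble_euler s c 1) \<alpha> = explicit_region (ensemble_euler s c 1)"
proof -
  have "stable_at (ensemble_euler s c 1) w w'"
    if w: "w \<in> explicit_region (ensemble_euler s c 1)"
      and w': "w' \<in> stiff_region (ensemble_euler s c 1) \<alpha>" for w w'
  proof (rule stable_at_ensemble_euler[OF _ inj])
    have "stable_at (ensemble_euler s c 1) 0 w'" and "in_sector \<alpha> w'"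
      using w' by (auto simp: stiff_region_def implicit_region_def)
    \<comment> \<open>Both branches of \<open>in_sector\<close> are strict conditions that fail at
      0, for every angle.\<close>
    then have "w' \<noteq> 0" by (auto simp: in_sector_def split: if_splits)
    with \<open>stable_at (ensemble_euler s c 1) 0 w'\<close> have "1 < cmod (1 - w')"
      using not_stable_at_ensemble_euler[OF s inj, of w' 0]
      by (cases "cmod (1 - w') \<le> 1") simp_all
    \<comment> \<open>Equality occurs at \<open>w = 0\<close>; the strictness needed below is
      supplied by \<open>w'\<close>.\<close>
    moreover have "cmod (1 + w) \<le> 1"
      using w unfolding explicit_region_ensemble_euler[OF s inj] by auto
    ultimately show "cmod (1 + w) < cmod (1 - w')" by simp
  qed (use s in simp)
  then show ?thesis by (auto simp: nonstiff_region_def)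
qed

theorem mainTheorem3:
  fixes s :: nat and c :: "real vec" and lam :: real
  assumes "s \<ge> 1"
    and "c \<in> carrier_vec s"
    and "inj_on (\<lambda>i. c $ i) {..<s}"
    and "lam > 0"
  shows "invertible_mat (C_mat s c)
    \<and> (\<forall>w w' :: complex. 1 - of_real lam * w' \<noteq> 0 \<longrightarrow>
        (let M = stability_mat (ensemble_euler s c lam) w w';
             T = 1\<^sub>m s
               + (w / (1 - of_real lam * w')) \<cdot>\<^sub>m cmat (F_mat s)
               + (w' / (1 - of_real lam * w')) \<cdot>\<^sub>m cmat (F_mat s * (1\<^sub>m s - lam \<cdot>\<^sub>m K_mat s))
         in stability_mat_defined (ensemble_euler s c lam) w w'
            \<and> cmat (mat_inv (C_mat s c)) * M * cmat (C_mat s c) = T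
            \<and> upper_triangular T
            \<and> spectrum M = {1 + (w + w') / (1 - of_real lam * w')}))
    \<and> (lam = 1 \<longrightarrow>
        (\<forall>w w' :: complex. 1 - w' \<noteq> 0 \<longrightarrow>
           spectrum (stability_mat (ensemble_euler s c lam) w w') = {(1 + w) / (1 - w')})
        \<and> (\<forall>(h :: real) (\<xi> :: complex) (\<xi>' :: complex) (y :: complex) (y' :: complex).
              1 - of_real h * \<xi>' \<noteq> 0 \<longrightarrow>
              (imex_euler_step h (\<lambda>u. \<xi> * u) (\<lambda>u. \<xi>' * u) y y' \<longleftrightarrow>
               y' = (1 + of_real h * \<xi>) / (1 - of_real h * \<xi>') * y)))
    \<and> (lam = 1 \<and> s > 1 \<longrightarrow>
        (\<forall>\<alpha> :: real. 0 \<le> \<alpha> \<and> \<alpha> \<le> pi / 2 \<longrightarrow>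
           nonstiff_region (ensemble_euler s c lam) \<alpha> = explicit_region (ensemble_euler s c lam)
           \<and> explicit_region (ensemble_euler s c lam) = {w. cmod (1 + w) < 1 \<or> w = 0}))"
proof -
  note s = assms(1) and inj = assms(3)
  have C: "C_mat s c \<in> carrier_mat s s" by (simp add: C_mat_def)
  note inv = mat_inv_det_nonzero[OF C det_C_mat_nonzero[OF inj]]
  have "invertible_mat (C_mat s c)"
    by (rule invertible_matI[OF C inv])
  \<comment> \<open>This is the similarity read from the triangular side.\<close>
  moreover have "cmat (mat_inv (C_mat s c)) * stability_mat (ensemble_euler s c lam) w w' * cmat (C_mat s c)
      = euler_triangle s lam w w'"
    if "1 - of_real lam * w' \<noteq> 0" for w w'
    using similar_mat_wit_sym[OF stability_mat_ensemble_euler[OF inj that, of w]]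
    unfolding similar_mat_wit_def Let_def by metis
  moreover have "spectrum (stability_mat (ensemble_euler s c 1) w w') = {(1 + w) / (1 - w')}"
    if "1 - w' \<noteq> 0" for w w'
    using spectrum_ensemble_euler[OF s inj, of 1 w' w] imex_euler_eigenvalue[OF that] that by simp
  \<comment> \<open>On the linear problem the step is a linear equation for \<open>y'\<close> with
    leading coefficient \<open>1 - of_real h * \<xi>'\<close>.\<close>
  moreover have "imex_euler_step h (\<lambda>u. \<xi> * u) (\<lambda>u. \<xi>' * u) y y' \<longleftrightarrow>
      y' = (1 + of_real h * \<xi>) / (1 - of_real h * \<xi>') * y"
    if "1 - of_real h * \<xi>' \<noteq> 0" for h \<xi> \<xi>' y y'
    using that by (simp add: imex_euler_step_def eq_divide_eq) (auto simp: algebra_simps)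
  \<comment> \<open>The body of \<open>euler_triangle\<close> is the matrix \<open>T\<close> of the
    statement verbatim, so folding its definition makes the lemmas applicable.\<close>
  ultimately show ?thesis
    using stability_mat_defined_ensemble_euler[OF s] spectrum_ensemble_euler[OF s inj]
      euler_triangle_upper_triangular[of s lam]
      explicit_region_ensemble_euler[OF _ inj] nonstiff_region_ensemble_euler[OF _ inj]
    unfolding Let_def euler_triangle_def[symmetric] by simp
qed

end
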